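(* Let $Y\sim N(0,1)$ be a standard normal random variable. For every integer $n\ge 0$, $$E[(Y)_{n,\lambda}]=\sum_{m=0}^{n}\sum_{k=0}^{[m/2]}\frac{(2k)!}{2^{k}k!}S_{1}(m,2k){n \brace m}_{\lambda}=\sum_{k=0}^{[n/2]}\sum_{m=2k}^{n}\frac{(2k)!}{2^{k}k!}S_{1}(m,2k){n \brace m}_{\lambda}.$$ In particular, $$E\big[(Y)_{2n,\lambda}\big]=\sum_{k=0}^{n}\sum_{m=2k}^{2n}\frac{(2k)!}{2^{k}k!}S_{1}(m,2k){2n \brace m}_{\lambda}.$$
   Context: $\lambda$ is a fixed nonzero real number, and $[\,\cdot\,]$ around a number (e.g. $[m/2]$) denotes the integer part. For real $x$ and $n\ge1$: $(x)_{n}=x(x-1)\cdots(x-n+1)$, $(x)_{n,\lambda}=x(x-\lambda)\cdots(x-(n-1)\lambda)$, and $(x)_0=(x)_{0,\lambda}=1$. The (signed) Stirling numbers of the first kind $S_1(n,k)$ and the degenerate Stirling numbers of the second kind ${n\brace k}_\lambda$ are defined by the polynomial identities $(x)_n=\sum_{k=0}^nS_1(n,k)x^k$ and $(x)_{n,\lambda}=\sum_{k=0}^n{n\brace k}_\lambda(x)_k$, $n\ge0$. *)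

theory Defs
  imports "HOL-Probability.Probability" "HOL-Combinatorics.Stirling"
begin

definition falling_fact :: "real \<Rightarrow> nat \<Rightarrow> real" where
  "falling_fact x n = (\<Prod>i<n. x - real i)"

definition deg_falling_fact :: "real \<Rightarrow> real \<Rightarrow> nat \<Rightarrow> real" where
  "deg_falling_fact lam x n = (\<Prod>i<n. x - real i * lam)"

text \<open>
  Both families of Stirling numbers are the coefficients in a polynomial identity, extended by
  zero outside the range of summation. That the descriptions are proper (the coefficients exist
  and are unique) is shown by the lemmas \<open>Stirling1_expansion\<close>, \<open>Stirling1_unique\<close>,
  \<open>deg_Stirling2_expansion\<close> and \<open>deg_Stirling2_unique\<close>. The library's \<open>stirling\<close> is the
  unsigned version of \<open>Stirling1\<close>, see \<open>Stirling1_conv_stirling\<close>.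
\<close>

definition Stirling1 :: "nat \<Rightarrow> nat \<Rightarrow> real" where
  "Stirling1 n =
     (THE c. (\<forall>x. falling_fact x n = (\<Sum>k\<le>n. c k * x ^ k)) \<and> (\<forall>k>n. c k = 0))"

definition deg_Stirling2 :: "real \<Rightarrow> nat \<Rightarrow> nat \<Rightarrow> real" where
  "deg_Stirling2 lam n =
     (THE c. (\<forall>x. deg_falling_fact lam x n = (\<Sum>k\<le>n. c k * falling_fact x k)) \<and>
             (\<forall>k>n. c k = 0))"

lemma falling_fact_conv_stirling:
  "falling_fact x n = (\<Sum>k\<le>n. (-1) ^ (n + k) * real (stirling n k) * x ^ k)"
proof -
  have "falling_fact x n = (\<Prod>i<n. (-1) * (- x + real i))"
    by (simp add: falling_fact_def)
  also have "\<dots> = (-1) ^ n * pochhammer (- x) n"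
    by (simp only: prod.distrib) (simp add: pochhammer_prod atLeast0LessThan)
  also have "\<dots> = (\<Sum>k\<le>n. (-1) ^ (n + k) * real (stirling n k) * x ^ k)"
    unfolding stirling_pochhammer [symmetric] sum_distrib_left
    by (rule sum.cong) (simp_all add: power_add power_minus [of x])
  finally show ?thesis .
qed

lemma Stirling1_ex1:
  "\<exists>!c. (\<forall>x. falling_fact x n = (\<Sum>k\<le>n. c k * x ^ k)) \<and> (\<forall>k>n. c k = 0)"
proof (rule ex_ex1I)
  show "\<exists>c. (\<forall>x. falling_fact x n = (\<Sum>k\<le>n. c k * x ^ k)) \<and> (\<forall>k>n. c k = 0)"
    by (rule exI [of _ "\<lambda>k. (-1) ^ (n + k) * real (stirling n k)"])
       (simp add: falling_fact_conv_stirling)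
next
  fix c d :: "nat \<Rightarrow> real"
  assume c: "(\<forall>x. falling_fact x n = (\<Sum>k\<le>n. c k * x ^ k)) \<and> (\<forall>k>n. c k = 0)"
    and d: "(\<forall>x. falling_fact x n = (\<Sum>k\<le>n. d k * x ^ k)) \<and> (\<forall>k>n. d k = 0)"
  then have "\<forall>x. (\<Sum>k\<le>n. c k * x ^ k) = (\<Sum>k\<le>n. d k * x ^ k)"
    by metis
  then have "\<forall>k\<le>n. c k = d k"
    by (simp add: polyfun_eq_coeffs)
  moreover have "\<forall>k>n. c k = d k"
    using c d by simp
  ultimately show "c = d"
    using not_le by blast
qed

lemma Stirling1_expansion: "falling_fact x n = (\<Sum>k\<le>n. Stirling1 n k * x ^ k)"
  and Stirling1_eq_0: "k > n \<Longrightarrow> Stirling1 n k = 0"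
  using theI' [OF Stirling1_ex1 [of n], folded Stirling1_def] by blast+

lemma Stirling1_unique:
  assumes "\<And>x. falling_fact x n = (\<Sum>k\<le>n. c k * x ^ k)" "k \<le> n"
  shows "Stirling1 n k = c k"
proof -
  have "\<forall>x. (\<Sum>k\<le>n. Stirling1 n k * x ^ k) = (\<Sum>k\<le>n. c k * x ^ k)"
    using assms(1) Stirling1_expansion by metis
  then show ?thesis
    using assms(2) by (simp add: polyfun_eq_coeffs)
qed

lemma Stirling1_conv_stirling: "Stirling1 n k = (-1) ^ (n + k) * real (stirling n k)"
proof (cases "k \<le> n")
  case True
  define c where "c = (\<lambda>k. (-1) ^ (n + k) * real (stirling n k))"
  have "falling_fact x n = (\<Sum>k\<le>n. c k * x ^ k)" for x
    unfolding c_def by (rule falling_fact_conv_stirling)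
  then have "Stirling1 n k = c k"
    using True by (rule Stirling1_unique)
  then show ?thesis
    by (simp only: c_def)
next
  case False
  then show ?thesis
    by (simp add: Stirling1_eq_0)
qed

lemma falling_fact_of_nat_eq_0: "j < k \<Longrightarrow> falling_fact (real j) k = 0"
  by (auto simp: falling_fact_def)

lemma falling_fact_of_nat_self: "falling_fact (real j) j \<noteq> 0"
  by (simp add: falling_fact_def)

lemma falling_fact_coeffs_unique:
  assumes eq: "\<And>x. (\<Sum>k\<le>n. c k * falling_fact x k) = (\<Sum>k\<le>n. d k * falling_fact x k)"
    and "k \<le> n"
  shows "c k = d k"
  using \<open>k \<le> n\<close>
proof (induction k rule: less_induct)
  case (less k)
  define e where "e = (\<lambda>k. c k - d k)"
  have sum0: "(\<Sum>i\<le>n. e i * falling_fact (real k) i) = 0"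
    using eq [of "real k"] by (simp add: e_def algebra_simps sum_subtractf)
  have zero: "e i * falling_fact (real k) i = 0" if "i \<in> {..n} - {k}" for i
    using that less falling_fact_of_nat_eq_0 [of k i]
    by (cases i k rule: linorder_cases) (auto simp: e_def)
  have "(\<Sum>i\<in>{..n} - {k}. e i * falling_fact (real k) i) = 0"
    using zero by (rule sum.neutral [OF ballI])
  then have "(\<Sum>i\<le>n. e i * falling_fact (real k) i) = e k * falling_fact (real k) k"
    using less.prems sum.remove [of "{..n}" k "\<lambda>i. e i * falling_fact (real k) i"]
    by simp
  with sum0 show ?case
    using falling_fact_of_nat_self [of k] by (simp add: e_def)
qed

lemma deg_falling_fact_expansion_ex:
  "\<exists>c. (\<forall>x. deg_falling_fact lam x n = (\<Sum>k\<le>n. c k * falling_fact x k)) \<and> (\<forall>k>n. c k = 0)"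
proof (induction n)
  case 0
  show ?case
    by (rule exI [of _ "\<lambda>k. if k = 0 then 1 else 0"])
       (simp add: deg_falling_fact_def falling_fact_def)
next
  case (Suc n)
  then obtain c where c: "\<And>x. deg_falling_fact lam x n = (\<Sum>k\<le>n. c k * falling_fact x k)"
    and c0: "\<And>k. k > n \<Longrightarrow> c k = 0"
    by blast
  define d where "d = (\<lambda>k. (if k = 0 then 0 else c (k - 1)) + (real k - real n * lam) * c k)"
  have "deg_falling_fact lam x (Suc n) = (\<Sum>k\<le>Suc n. d k * falling_fact x k)" for x
  proof -
    have step: "(x - real n * lam) * (c k * falling_fact x k)
        = c k * falling_fact x (Suc k) + (real k - real n * lam) * c k * falling_fact x k" for k
      by (simp add: falling_fact_def algebra_simps)
    have "deg_falling_fact lam x (Suc n) = (x - real n * lam) * deg_falling_fact lam x n"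
      by (simp add: deg_falling_fact_def)
    also have "\<dots> = (\<Sum>k\<le>n. c k * falling_fact x (Suc k))
        + (\<Sum>k\<le>n. (real k - real n * lam) * c k * falling_fact x k)"
      by (simp add: c sum_distrib_left step sum.distrib)
    also have "(\<Sum>k\<le>n. c k * falling_fact x (Suc k))
        = (\<Sum>k\<le>Suc n. (if k = 0 then 0 else c (k - 1)) * falling_fact x k)"
      by (simp add: sum.atMost_Suc_shift del: sum.atMost_Suc)
    also have "(\<Sum>k\<le>n. (real k - real n * lam) * c k * falling_fact x k)
        = (\<Sum>k\<le>Suc n. (real k - real n * lam) * c k * falling_fact x k)"
      by (simp add: c0)
    finally show ?thesis
      by (simp add: d_def distrib_right sum.distrib del: sum.atMost_Suc)
  qed
  moreover have "\<forall>k>Suc n. d k = 0"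
    by (simp add: d_def c0)
  ultimately show ?case
    by blast
qed

lemma deg_Stirling2_ex1:
  "\<exists>!c. (\<forall>x. deg_falling_fact lam x n = (\<Sum>k\<le>n. c k * falling_fact x k)) \<and> (\<forall>k>n. c k = 0)"
proof (rule ex_ex1I [OF deg_falling_fact_expansion_ex])
  fix c d :: "nat \<Rightarrow> real"
  assume c: "(\<forall>x. deg_falling_fact lam x n = (\<Sum>k\<le>n. c k * falling_fact x k)) \<and> (\<forall>k>n. c k = 0)"
    and d: "(\<forall>x. deg_falling_fact lam x n = (\<Sum>k\<le>n. d k * falling_fact x k)) \<and> (\<forall>k>n. d k = 0)"
  have "(\<Sum>k\<le>n. c k * falling_fact x k) = (\<Sum>k\<le>n. d k * falling_fact x k)" for x
    using c d by metis
  then have "c k = d k" if "k \<le> n" for k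
    using that by (rule falling_fact_coeffs_unique [where c = c and d = d])
  moreover have "\<forall>k>n. c k = d k"
    using c d by simp
  ultimately show "c = d"
    using not_le by blast
qed

lemma deg_Stirling2_expansion:
    "deg_falling_fact lam x n = (\<Sum>k\<le>n. deg_Stirling2 lam n k * falling_fact x k)"
  and deg_Stirling2_eq_0: "k > n \<Longrightarrow> deg_Stirling2 lam n k = 0"
  using theI' [OF deg_Stirling2_ex1 [of lam n], folded deg_Stirling2_def] by blast+

lemma deg_Stirling2_unique:
  assumes "\<And>x. deg_falling_fact lam x n = (\<Sum>k\<le>n. c k * falling_fact x k)" "k \<le> n"
  shows "deg_Stirling2 lam n k = c k"
proof (rule falling_fact_coeffs_unique [where c = "deg_Stirling2 lam n" and d = c])
  show "(\<Sum>k\<le>n. deg_Stirling2 lam n k * falling_fact x k)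
      = (\<Sum>k\<le>n. c k * falling_fact x k)" for x
    using assms(1) deg_Stirling2_expansion by metis
qed (fact assms(2))

end

theory Submission
  imports Defs
begin

text \<open>Two changes of basis turn (Y)_{n,lam} into a polynomial in Y:
  \<open>deg_Stirling2_expansion\<close> passes to falling factorials, and
  \<open>Stirling1_expansion\<close> passes from these to powers. All moments of a standard normal
  variable are finite, so expectation goes through both finite sums. Odd moments vanish by symmetry
  and the moment of order 2k is (2k)!/(2^k k!), so only the even columns of \<open>Stirling1\<close>
  survive (\<open>sum_odd_eq_0\<close>); this is the first double sum,
  \<open>std_normal_integral_deg_falling_fact\<close>. The second is the same sum over a triangle
  taken in the other order, \<open>sum_div2_swap\<close>, and the final formula is the case of index
  2n.\<close>

lemma sum_odd_eq_0:
  fixes f :: "nat \<Rightarrow> 'a::comm_monoid_add"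
  assumes "\<And>k. odd k \<Longrightarrow> f k = 0"
  shows "(\<Sum>k\<le>n. f k) = (\<Sum>k=0..n div 2. f (2 * k))"
proof -
  \<comment> \<open>Doubling maps 0..n div 2 onto exactly the even numbers up to n, so the discarded
    indices are all odd.\<close>
  have "(\<Sum>k\<le>n. f k) = sum f ((*) 2 ` {0..n div 2})"
    by (rule sum.mono_neutral_right) (auto simp: image_iff intro!: assms elim!: evenE)
  also have "\<dots> = (\<Sum>k=0..n div 2. f (2 * k))"
    by (subst sum.reindex) (auto simp: inj_on_def)
  finally show ?thesis .
qed

text \<open>Both sides range over the pairs with 2k \<le> m \<le> n, since k \<le> m div 2 means 2k
  \<le> m.\<close>

lemma sum_div2_swap:
  fixes f :: "nat \<Rightarrow> nat \<Rightarrow> 'a::comm_monoid_add"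
  shows "(\<Sum>m=0..n. \<Sum>k=0..m div 2. f m k) = (\<Sum>k=0..n div 2. \<Sum>m=2*k..n. f m k)"
proof -
  \<comment> \<open>The triangle is cut out of a fixed rectangle by the condition 2k \<le> m, the
    shape in which \<open>sum.swap_restrict\<close> applies.\<close>
  have "(\<Sum>m=0..n. \<Sum>k=0..m div 2. f m k)
      = (\<Sum>m=0..n. \<Sum>k | k \<in> {0..n div 2} \<and> 2 * k \<le> m. f m k)"
    by (intro sum.cong) auto
  also have "\<dots> = (\<Sum>k=0..n div 2. \<Sum>m | m \<in> {0..n} \<and> 2 * k \<le> m. f m k)"
    by (rule sum.swap_restrict) auto
  also have "\<dots> = (\<Sum>k=0..n div 2. \<Sum>m=2*k..n. f m k)"
    by (intro sum.cong) auto
  finally show ?thesis .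
qed

context
  fixes M :: "'a measure" and Y :: "'a \<Rightarrow> real"
  assumes Y: "distributed M lborel Y std_normal_density"
begin

text \<open>The density of Y carries the question from M to the real line, where the Gaussian
  moments are known.\<close>

lemma std_normal_power_integrable: "integrable M (\<lambda>\<omega>. Y \<omega> ^ k)"
  using distributed_integrable[OF Y, of "\<lambda>x. x ^ k"] integrable_std_normal_moment[of k]
  by simp

lemma std_normal_integral_power: "(\<integral>\<omega>. Y \<omega> ^ k \<partial>M) = (\<integral>x. std_normal_density x * x ^ k \<partial>lborel)"
  using distributed_integral[OF Y, of "\<lambda>x. x ^ k"] by simp

lemma std_normal_integral_power_even:
  "(\<integral>\<omega>. Y \<omega> ^ (2 * k) \<partial>M) = fact (2 * k) / (2 ^ k * fact k)"
  unfolding std_normal_integral_power by (rule integral_std_normal_moment_even)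

lemma std_normal_integral_power_odd: "odd k \<Longrightarrow> (\<integral>\<omega>. Y \<omega> ^ k \<partial>M) = 0"
  unfolding std_normal_integral_power
  by (metis oddE integral_std_normal_moment_odd)

text \<open>Integrability is recorded separately because exchanging the Bochner integral with the
  outer sum needs every summand integrable.\<close>

lemma std_normal_falling_fact_integrable: "integrable M (\<lambda>\<omega>. falling_fact (Y \<omega>) m)"
  unfolding Stirling1_expansion
  by (intro Bochner_Integration.integrable_sum integrable_mult_right std_normal_power_integrable)

lemma std_normal_integral_falling_fact:
  "(\<integral>\<omega>. falling_fact (Y \<omega>) m \<partial>M)
    = (\<Sum>k=0..m div 2. fact (2 * k) / (2 ^ k * fact k) * Stirling1 m (2 * k))"
proof -
  have "(\<integral>\<omega>. falling_fact (Y \<omega>) m \<partial>M) = (\<Sum>k\<le>m. Stirling1 m k * (\<integral>\<omega>. Y \<omega> ^ k \<partial>M))"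
    unfolding Stirling1_expansion
    by (subst Bochner_Integration.integral_sum)
       (auto intro!: integrable_mult_right std_normal_power_integrable)
  \<comment> \<open>The vanishing odd moments leave only even exponents, which is where the bound m
    div 2 comes from.\<close>
  also have "\<dots> = (\<Sum>k=0..m div 2. Stirling1 m (2 * k) * (\<integral>\<omega>. Y \<omega> ^ (2 * k) \<partial>M))"
    by (rule sum_odd_eq_0) (simp add: std_normal_integral_power_odd)
  finally show ?thesis
    by (simp only: std_normal_integral_power_even mult.commute [of "Stirling1 _ _"])
qed

lemma std_normal_deg_falling_fact_integrable:
  "integrable M (\<lambda>\<omega>. deg_falling_fact lam (Y \<omega>) n)"
  unfolding deg_Stirling2_expansion
  by (intro Bochner_Integration.integrable_sum integrable_mult_right
      std_normal_falling_fact_integrable)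

lemma std_normal_integral_deg_falling_fact:
  "(\<integral>\<omega>. deg_falling_fact lam (Y \<omega>) n \<partial>M)
    = (\<Sum>m=0..n. \<Sum>k=0..m div 2.
         fact (2 * k) / (2 ^ k * fact k) * Stirling1 m (2 * k) * deg_Stirling2 lam n m)"
proof -
  have "(\<integral>\<omega>. deg_falling_fact lam (Y \<omega>) n \<partial>M)
      = (\<Sum>m\<le>n. deg_Stirling2 lam n m * (\<integral>\<omega>. falling_fact (Y \<omega>) m \<partial>M))"
    unfolding deg_Stirling2_expansion
    by (subst Bochner_Integration.integral_sum)
       (auto intro!: integrable_mult_right std_normal_falling_fact_integrable)
  then show ?thesis
    by (simp add: std_normal_integral_falling_fact sum_distrib_left atLeast0AtMost mult_ac)
qed

end

theorem theorem3p1: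
  fixes lam :: real and M :: "'a measure" and Y :: "'a \<Rightarrow> real" and n :: nat
  assumes "lam \<noteq> 0"
    and "prob_space M"
    and "distributed M lborel Y std_normal_density"
  shows "integrable M (\<lambda>\<omega>. deg_falling_fact lam (Y \<omega>) n)
    \<and> prob_space.expectation M (\<lambda>\<omega>. deg_falling_fact lam (Y \<omega>) n)
        = (\<Sum>m=0..n. \<Sum>k=0..m div 2.
             fact (2 * k) / (2 ^ k * fact k) * Stirling1 m (2 * k) * deg_Stirling2 lam n m)
    \<and> (\<Sum>m=0..n. \<Sum>k=0..m div 2.
          fact (2 * k) / (2 ^ k * fact k) * Stirling1 m (2 * k) * deg_Stirling2 lam n m)
        = (\<Sum>k=0..n div 2. \<Sum>m=2*k..n.
             fact (2 * k) / (2 ^ k * fact k) * Stirling1 m (2 * k) * deg_Stirling2 lam n m)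
    \<and> prob_space.expectation M (\<lambda>\<omega>. deg_falling_fact lam (Y \<omega>) (2 * n))
        = (\<Sum>k=0..n. \<Sum>m=2*k..2*n.
             fact (2 * k) / (2 ^ k * fact k) * Stirling1 m (2 * k) * deg_Stirling2 lam (2 * n) m)"
proof (intro conjI)
  note E = std_normal_integral_deg_falling_fact[OF assms(3)]
  show "integrable M (\<lambda>\<omega>. deg_falling_fact lam (Y \<omega>) n)"
    by (rule std_normal_deg_falling_fact_integrable[OF assms(3)])
  show "prob_space.expectation M (\<lambda>\<omega>. deg_falling_fact lam (Y \<omega>) n)
      = (\<Sum>m=0..n. \<Sum>k=0..m div 2.
           fact (2 * k) / (2 ^ k * fact k) * Stirling1 m (2 * k) * deg_Stirling2 lam n m)"
    by (rule E)
  show "(\<Sum>m=0..n. \<Sum>k=0..m div 2.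
          fact (2 * k) / (2 ^ k * fact k) * Stirling1 m (2 * k) * deg_Stirling2 lam n m)
      = (\<Sum>k=0..n div 2. \<Sum>m=2*k..n.
          fact (2 * k) / (2 ^ k * fact k) * Stirling1 m (2 * k) * deg_Stirling2 lam n m)"
    by (rule sum_div2_swap)
  show "prob_space.expectation M (\<lambda>\<omega>. deg_falling_fact lam (Y \<omega>) (2 * n))
      = (\<Sum>k=0..n. \<Sum>m=2*k..2*n.
          fact (2 * k) / (2 ^ k * fact k) * Stirling1 m (2 * k) * deg_Stirling2 lam (2 * n) m)"
    \<comment> \<open>At index 2n the outer bound (2n) div 2 is n.\<close>
    unfolding E sum_div2_swap by simp
qed

end
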